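(* Let $N\ge2$ be an integer, $K,\mu,\omega_M>0$, $\tau\ge0$, let $\Omega\in\mathbb{R}$ satisfy $\Omega=-K\sin((\Omega+\omega_M)\tau)$, and put $\widehat\Omega=\Omega+\omega_M$. Let $\triangle(\lambda,\tau)\in\mathbb{C}^{2N\times2N}$ be the characteristic matrix of the linearization of the phase model, written in the frame rotating with frequency $\Omega$, at the equilibrium $x=0$ corresponding to the relative equilibrium $\theta_k(t)=\Omega t$, $k=1,\dots,N$. Then for all $\lambda\in\mathbb{C}$ $$\det\triangle(\lambda,\tau)=P_{\mathrm{Fix}}(\lambda,\tau)\,\bigl(P_U(\lambda,\tau)\bigr)^{N-1},$$ where $$P_{\mathrm{Fix}}(\lambda,\tau)=\lambda^2+\mu\lambda+K\mu\cos(\widehat\Omega\tau)-K\mu\cos(\widehat\Omega\tau)e^{-\lambda\tau},$$ $$P_U(\lambda,\tau)=\lambda^2+\mu\lambda+K\mu\cos(\widehat\Omega\tau)+\frac{K\mu}{N-1}\cos(\widehat\Omega\tau)e^{-\lambda\tau}.$$ In particular, $\lambda=0$ is a root of $P_{\mathrm{Fix}}(\cdot,\tau)$ for all parameter values.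
   Context: The phase model is the system $$\ddot\theta_i(t)+\mu\dot\theta_i(t)-\frac{K\mu}{N-1}\sum_{j=1,\,j\neq i}^N\sin(\theta_j(t-\tau)-\theta_i(t)-\omega_M\tau)=0,\qquad i=1,\dots,N.$$ In the rotating frame $\vartheta_k(t)=\theta_k(t)-\Omega t$, with $x_1^{(i)}=\vartheta_i$, $x_2^{(i)}=\dot\vartheta_i$, it becomes $\dot x(t)=f(x(t),x(t-\tau))$, that is, $$\dot x_1^{(i)}=x_2^{(i)},\qquad \dot x_2^{(i)}=-\mu x_2^{(i)}-\mu\Omega+\frac{K\mu}{N-1}\sum_{j=1,\,j\ne i}^N\sin\bigl(x_1^{(j)}(t-\tau)-x_1^{(i)}(t)-\Omega\tau-\omega_M\tau\bigr),$$ for $i=1,\dots,N$, which has the equilibrium $x=0$. Let $A_0$ and $A_\tau$ be the Jacobians of $f$ with respect to its first and second argument at $(0,0)$. The characteristic matrix is $\triangle(\lambda,\tau)=\lambda\,\mathrm{Id}-A_0-A_\tau e^{-\lambda\tau}$. *)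

theory Defs
  imports "HOL-Analysis.Analysis"
begin

(* The N oscillators are the elements of the finite type 'n, so N = CARD('n).
   The state x in R^(2N) is indexed by 'n + 'n: the coordinate Inl i is x_1^(i), the phase of
   oscillator i in the rotating frame, and Inr i is x_2^(i), its velocity. *)

(* Left-hand side of the i-th equation of the phase model, given the phases th, velocities v and
   accelerations a at time t and the phases thd at time t - tau. *)
definition phase_eq ::
  "real \<Rightarrow> real \<Rightarrow> real \<Rightarrow> real \<Rightarrow> ('n::finite \<Rightarrow> real) \<Rightarrow> ('n \<Rightarrow> real) \<Rightarrow> ('n \<Rightarrow> real)
     \<Rightarrow> ('n \<Rightarrow> real) \<Rightarrow> 'n \<Rightarrow> real"
where
  "phase_eq K \<mu> \<omega>M \<tau> th v a thd i =
     a i + \<mu> * v i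
       - K * \<mu> / (real CARD('n) - 1) * (\<Sum>j\<in>UNIV - {i}. sin (thd j - th i - \<omega>M * \<tau>))"

definition phase_field ::
  "real \<Rightarrow> real \<Rightarrow> real \<Rightarrow> real \<Rightarrow> real \<Rightarrow> real ^ ('n::finite + 'n) \<Rightarrow> real ^ ('n + 'n)
     \<Rightarrow> real ^ ('n + 'n)"
where
  "phase_field K \<mu> \<omega>M \<tau> \<Omega> x y = (\<chi> k. case k of
      Inl i \<Rightarrow> x $ Inr i
    | Inr i \<Rightarrow> - \<mu> * x $ Inr i - \<mu> * \<Omega>
        + K * \<mu> / (real CARD('n) - 1)
          * (\<Sum>j\<in>UNIV - {i}. sin (y $ Inl j - x $ Inl i - \<Omega> * \<tau> - \<omega>M * \<tau>)))"

definition jac_A0 :: "real \<Rightarrow> real \<Rightarrow> real \<Rightarrow> real \<Rightarrow> real \<Rightarrow> real ^ ('n::finite + 'n) ^ ('n + 'n)" where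
  "jac_A0 K \<mu> \<omega>M \<tau> \<Omega> = jacobian (\<lambda>x. phase_field K \<mu> \<omega>M \<tau> \<Omega> x 0) (at 0)"

definition jac_Atau :: "real \<Rightarrow> real \<Rightarrow> real \<Rightarrow> real \<Rightarrow> real \<Rightarrow> real ^ ('n::finite + 'n) ^ ('n + 'n)" where
  "jac_Atau K \<mu> \<omega>M \<tau> \<Omega> = jacobian (\<lambda>y. phase_field K \<mu> \<omega>M \<tau> \<Omega> 0 y) (at 0)"

(* mat z is z times the identity matrix. *)
definition char_matrix ::
  "real \<Rightarrow> real \<Rightarrow> real \<Rightarrow> real \<Rightarrow> complex \<Rightarrow> real \<Rightarrow> complex ^ ('n::finite + 'n) ^ ('n + 'n)"
where
  "char_matrix K \<mu> \<omega>M \<Omega> z \<tau> =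
     mat z - map_matrix of_real (jac_A0 K \<mu> \<omega>M \<tau> \<Omega>)
       - map_matrix (\<lambda>a. of_real a * exp (- z * of_real \<tau>)) (jac_Atau K \<mu> \<omega>M \<tau> \<Omega>)"

(* In P_Fix and P_U, the argument W stands for the frequency Omega + omega_M. *)
definition P_Fix :: "real \<Rightarrow> real \<Rightarrow> real \<Rightarrow> complex \<Rightarrow> real \<Rightarrow> complex" where
  "P_Fix K \<mu> W z \<tau> =
     z\<^sup>2 + of_real \<mu> * z + of_real (K * \<mu> * cos (W * \<tau>))
       - of_real (K * \<mu> * cos (W * \<tau>)) * exp (- z * of_real \<tau>)"

definition P_U :: "nat \<Rightarrow> real \<Rightarrow> real \<Rightarrow> real \<Rightarrow> complex \<Rightarrow> real \<Rightarrow> complex" where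
  "P_U N K \<mu> W z \<tau> =
     z\<^sup>2 + of_real \<mu> * z + of_real (K * \<mu> * cos (W * \<tau>))
       + of_real (K * \<mu> / (real N - 1) * cos (W * \<tau>)) * exp (- z * of_real \<tau>)"

(* phase_field is the phase model in the frame rotating with frequency Omega. *)
lemma phase_field_rotating_frame:
  fixes th v :: "'n::finite \<Rightarrow> real \<Rightarrow> real" and x :: "real \<Rightarrow> real ^ ('n + 'n)"
  assumes th: "\<And>i t. (th i has_real_derivative v i t) (at t)"
  assumes x: "x = (\<lambda>t. \<chi> k. case k of Inl i \<Rightarrow> th i t - \<Omega> * t | Inr i \<Rightarrow> v i t - \<Omega>)"
  shows "(x has_vector_derivative phase_field K \<mu> \<omega>M \<tau> \<Omega> (x t) (x (t - \<tau>))) (at t) \<longleftrightarrow>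
    (\<exists>a. \<forall>i. (v i has_real_derivative a i) (at t) \<and>
       phase_eq K \<mu> \<omega>M \<tau> (\<lambda>j. th j t) (\<lambda>j. v j t) a (\<lambda>j. th j (t - \<tau>)) i = 0)"
proof -
  define F where "F = phase_field K \<mu> \<omega>M \<tau> \<Omega> (x t) (x (t - \<tau>))"
  have arg: "th j (t - \<tau>) - \<Omega> * (t - \<tau>) - (th i t - \<Omega> * t) - \<Omega> * \<tau> - \<omega>M * \<tau>
      = th j (t - \<tau>) - th i t - \<omega>M * \<tau>" for i j
    by (simp add: algebra_simps)
  have FR: "F $ Inr i = - \<mu> * v i t + K * \<mu> / (real CARD('n) - 1)
      * (\<Sum>j\<in>UNIV - {i}. sin (th j (t - \<tau>) - th i t - \<omega>M * \<tau>))" for i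
    unfolding F_def phase_field_def x by (simp add: arg) (simp add: algebra_simps)
  have FL: "F $ Inl i = v i t - \<Omega>" for i
    unfolding F_def phase_field_def x by simp
  have comp: "(x has_vector_derivative F) (at t) \<longleftrightarrow>
      (\<forall>k. ((\<lambda>s. x s $ k) has_real_derivative F $ k) (at t))"
    unfolding has_vector_derivative_def has_derivative_componentwise_within[of x]
    by (simp add: Basis_vec_def inner_axis has_field_derivative_def mult_commute_abs)
  have L: "((\<lambda>s. x s $ Inl i) has_real_derivative F $ Inl i) (at t)" for i
    unfolding FL x using th[of i t] by (auto intro!: derivative_eq_intros)
  have R: "((\<lambda>s. x s $ Inr i) has_real_derivative F $ Inr i) (at t) \<longleftrightarrow>
      (v i has_real_derivative F $ Inr i) (at t)" for i
  proof
    assume "((\<lambda>s. x s $ Inr i) has_real_derivative F $ Inr i) (at t)"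
    then have "((\<lambda>s. x s $ Inr i + \<Omega>) has_real_derivative F $ Inr i + 0) (at t)"
      by (intro DERIV_add DERIV_const)
    then show "(v i has_real_derivative F $ Inr i) (at t)" by (simp add: x)
  next
    assume "(v i has_real_derivative F $ Inr i) (at t)"
    then have "((\<lambda>s. v i s - \<Omega>) has_real_derivative F $ Inr i - 0) (at t)"
      by (intro DERIV_diff DERIV_const)
    then show "((\<lambda>s. x s $ Inr i) has_real_derivative F $ Inr i) (at t)" by (simp add: x)
  qed
  have eq: "phase_eq K \<mu> \<omega>M \<tau> (\<lambda>j. th j t) (\<lambda>j. v j t) a (\<lambda>j. th j (t - \<tau>)) i = 0
      \<longleftrightarrow> a i = F $ Inr i" for a i
    unfolding phase_eq_def FR by linarith
  have "(x has_vector_derivative F) (at t) \<longleftrightarrow> (\<forall>i. (v i has_real_derivative F $ Inr i) (at t))"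
    unfolding comp using L R by (metis sum.exhaust)
  also have "\<dots> \<longleftrightarrow> (\<exists>a. \<forall>i. (v i has_real_derivative a i) (at t) \<and> a i = F $ Inr i)"
    by (rule iffI, rule exI[of _ "\<lambda>i. F $ Inr i"], simp, metis)
  finally show ?thesis unfolding eq F_def .
qed

lemma phase_field_equilibrium:
  assumes "CARD('n::finite) \<ge> 2" and "\<Omega> = - K * sin ((\<Omega> + \<omega>M) * \<tau>)"
  shows "phase_field K \<mu> \<omega>M \<tau> \<Omega> (0 :: real ^ ('n + 'n)) 0 = 0"
proof -
  have N: "real CARD('n) - 1 \<noteq> 0" using assms(1) by simp
  have s: "sin (- (\<Omega> * \<tau>) - \<omega>M * \<tau>) = - sin ((\<Omega> + \<omega>M) * \<tau>)"
    by (metis add.commute diff_conv_add_uminus distrib_right minus_add_distrib sin_minus)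
  have c: "real (card (UNIV - {i::'n})) = real CARD('n) - 1" for i
    using assms(1) by (simp add: card_Diff_singleton of_nat_diff)
  have "- (\<mu> * \<Omega>) - K * \<mu> * sin ((\<Omega> + \<omega>M) * \<tau>) = - \<mu> * (\<Omega> + K * sin ((\<Omega> + \<omega>M) * \<tau>))"
    by (simp add: algebra_simps)
  also have "\<dots> = 0" using assms(2) by simp
  finally show ?thesis
    unfolding vec_eq_iff phase_field_def
    using N by (auto simp: s c split: sum.split)
qed

end

(* In block form the characteristic matrix is [[z I, -I], [C, (z + mu) I]]. Multiplying it by
   block matrices of determinant 1 reduces its determinant to that of C + z (z + mu) I, which is
   a scalar matrix plus a multiple of the all-ones matrix, so that the determinant formula for a
   rank-one perturbation of a diagonal matrix applies. *)

theory Submission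
  imports Defs
begin

section \<open>Determinant of a diagonal matrix plus a rank-one matrix\<close>

text \<open>By linearity in row \<open>r\<close>, \<open>w\<close> splits into its diagonal entry,
  which leaves a diagonal matrix, and a remainder vanishing at \<open>r\<close>, which makes column
  \<open>r\<close> zero.\<close>

lemma det_diagonal_replace_row:
  fixes d :: "'n::finite \<Rightarrow> 'a::field" and w :: "'a ^ 'n"
  shows "det (\<chi> i. if i = r then w else axis i (d i)) = w $ r * (\<Prod>j\<in>UNIV - {r}. d j)"
proof -
  define w' where "w' = (\<chi> j. if j = r then 0 else w $ j)"
  let ?A = "\<lambda>x. (\<chi> i. if i = r then x else axis i (d i)) :: 'a ^ 'n ^ 'n"
  have w: "w = axis r (w $ r) + w'"
    by (simp add: vec_eq_iff axis_def w'_def)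
  have "det (?A w) = det (?A (axis r (w $ r))) + det (?A w')"
    by (subst w) (rule det_row_add)
  also have "det (?A w') = 0"
    by (rule det_zero_column(2)[of r])
      (simp add: column_def vec_eq_iff w'_def axis_def)
  also have "det (?A (axis r (w $ r))) = (\<Prod>i\<in>UNIV. ?A (axis r (w $ r)) $ i $ i)"
    by (rule det_diagonal) (auto simp: axis_def)
  also have "\<dots> = w $ r * (\<Prod>j\<in>UNIV - {r}. d j)"
    by (subst prod.remove[of _ r]) (auto simp: axis_def intro!: prod.cong)
  finally show ?thesis by simp
qed

text \<open>The matrix determinant lemma in a division-free form, which covers vanishing
  \<open>d i\<close>. The perturbation is switched on row by row; \<open>R S\<close> is the stage at
  which exactly the rows in \<open>S\<close> carry it.\<close>

lemma det_diagonal_plus_rank_one: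
  fixes d u :: "'n::finite \<Rightarrow> 'a::field" and w :: "'a ^ 'n"
  shows "det (\<chi> i. axis i (d i) + u i *s w)
    = (\<Prod>i\<in>UNIV. d i) + (\<Sum>i\<in>UNIV. u i * w $ i * (\<Prod>j\<in>UNIV - {i}. d j))"
proof -
  define R where "R S i = (if i \<in> S then axis i (d i) + u i *s w else axis i (d i))" for S i
  \<comment> \<open>Once row \<open>r\<close> is \<open>w\<close> itself, multiples of it clear
    \<open>u i *s w\<close> from all other rows, so the value is the same for every such
    \<open>S\<close>.\<close>
  have repl: "det (\<chi> i. if i = r then w else R S i) = w $ r * (\<Prod>j\<in>UNIV - {r}. d j)"
    if "r \<notin> S" for r S
    using finite[of S] that
  proof (induction S rule: finite_induct)
    case empty
    show ?case by (simp add: R_def det_diagonal_replace_row cong: if_cong)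
  next
    case (insert s S)
    let ?A = "(\<chi> i. if i = r then w else R S i) :: 'a ^ 'n ^ 'n"
    have "(\<chi> i. if i = r then w else R (insert s S) i)
        = (\<chi> k. if k = s then row s ?A + u s *s row r ?A else row k ?A)"
      using insert.hyps insert.prems by (auto simp: vec_eq_iff row_def R_def)
    also have "det \<dots> = det ?A"
      using insert.prems by (intro det_row_operation) auto
    finally show ?case using insert by simp
  qed
  \<comment> \<open>Linearity in the newly switched row \<open>s\<close> adds \<open>u s\<close>
    times a determinant with \<open>w\<close> in that row, which \<open>repl\<close>
    evaluates.\<close>
  have "det (\<chi> i. R S i)
      = (\<Prod>i\<in>UNIV. d i) + (\<Sum>i\<in>S. u i * w $ i * (\<Prod>j\<in>UNIV - {i}. d j))" for S
    using finite[of S]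
  proof (induction S rule: finite_induct)
    case empty
    show ?case by (subst det_diagonal) (auto simp: R_def axis_def)
  next
    case (insert s S)
    have "(\<chi> i. R (insert s S) i) = (\<chi> i. if i = s then axis s (d s) + u s *s w else R S i)"
      by (simp add: vec_eq_iff R_def)
    also have "det \<dots> = det (\<chi> i. if i = s then axis s (d s) else R S i)
        + u s * det (\<chi> i. if i = s then w else R S i)"
      by (simp add: det_row_add det_row_mul)
    also have "(\<chi> i. if i = s then axis s (d s) else R S i) = (\<chi> i. R S i)"
      using insert.hyps by (auto simp: vec_eq_iff R_def)
    finally show ?case using insert by (simp add: repl)
  qed
  from this[of UNIV] show ?thesis by (simp add: R_def)
qed

section \<open>Arithmetic of block matrices and scalar matrices\<close>

definition block_matrix ::
  "'a ^ 'n ^ 'm \<Rightarrow> 'a ^ 'l ^ 'm \<Rightarrow> 'a ^ 'n ^ 'k \<Rightarrow> 'a ^ 'l ^ 'k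
     \<Rightarrow> 'a ^ ('n::finite + 'l::finite) ^ ('m::finite + 'k::finite)"
where
  "block_matrix A B C D = (\<chi> i j. case i of
      Inl i \<Rightarrow> (case j of Inl j \<Rightarrow> A $ i $ j | Inr j \<Rightarrow> B $ i $ j)
    | Inr i \<Rightarrow> (case j of Inl j \<Rightarrow> C $ i $ j | Inr j \<Rightarrow> D $ i $ j))"

lemma block_matrix_nth [simp]:
  "block_matrix A B C D $ Inl i $ Inl j = A $ i $ j"
  "block_matrix A B C D $ Inl i $ Inr l = B $ i $ l"
  "block_matrix A B C D $ Inr k $ Inl j = C $ k $ j"
  "block_matrix A B C D $ Inr k $ Inr l = D $ k $ l"
  by (simp_all add: block_matrix_def)

lemma block_matrix_eqI:
  assumes "\<And>i j. M $ Inl i $ Inl j = A $ i $ j" "\<And>i j. M $ Inl i $ Inr j = B $ i $ j"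
    and "\<And>i j. M $ Inr i $ Inl j = C $ i $ j" "\<And>i j. M $ Inr i $ Inr j = D $ i $ j"
  shows "M = block_matrix A B C D"
  unfolding vec_eq_iff
proof (intro allI)
  fix i j
  show "M $ i $ j = block_matrix A B C D $ i $ j"
    by (cases i; cases j) (simp_all add: assms)
qed

lemma sum_UNIV_Plus:
  "(\<Sum>k\<in>UNIV. f k) = (\<Sum>i\<in>UNIV. f (Inl i)) + (\<Sum>j\<in>UNIV. f (Inr j))"
  for f :: "'a::finite + 'b::finite \<Rightarrow> 'c::comm_monoid_add"
  unfolding UNIV_Plus_UNIV[symmetric] by (subst sum.Plus) simp_all

lemma prod_UNIV_Plus:
  "(\<Prod>k\<in>UNIV. f k) = (\<Prod>i\<in>UNIV. f (Inl i)) * (\<Prod>j\<in>UNIV. f (Inr j))"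
  for f :: "'a::finite + 'b::finite \<Rightarrow> 'c::comm_monoid_mult"
  unfolding UNIV_Plus_UNIV[symmetric] by (subst prod.Plus) simp_all

lemma block_matrix_mult:
  "block_matrix A B C D ** block_matrix A' B' C' D'
    = block_matrix (A ** A' + B ** C') (A ** B' + B ** D') (C ** A' + D ** C') (C ** B' + D ** D')"
  by (rule block_matrix_eqI) (simp_all add: matrix_matrix_mult_def sum_UNIV_Plus)

lemma mat_nth: "mat a $ i $ j = (if i = j then a else 0)"
  by (simp add: mat_def)

lemma mat_eq_block_matrix: "mat a = block_matrix (mat a) 0 0 (mat a)"
  by (rule block_matrix_eqI) (simp_all add: mat_nth)

lemma mat_matrix_mult_nth [simp]: "(mat a ** A) $ i $ j = a * A $ i $ j"
  for a :: "'a::semiring_1"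
  by (simp add: matrix_matrix_mult_def mat_def if_distrib if_distribR cong: if_cong)

lemma matrix_mat_mult_nth [simp]: "(A ** mat a) $ i $ j = A $ i $ j * a"
  for a :: "'a::semiring_1"
  by (simp add: matrix_matrix_mult_def mat_def if_distrib if_distribR cong: if_cong)

lemma mat_add: "mat a + mat b = mat (a + b)" for a :: "'a::semiring_1"
  by (simp add: vec_eq_iff mat_nth)

lemma mat_mult: "mat a ** mat b = mat (a * b)" for a :: "'a::semiring_1"
  by (simp add: vec_eq_iff mat_nth)

lemma matrix_zero_mult [simp]: "0 ** A = 0" "A ** 0 = 0" for A :: "'a::semiring_1 ^ 'n ^ 'm"
  by (simp_all add: matrix_matrix_mult_def vec_eq_iff)

section \<open>Determinants of block matrices\<close>

text \<open>The index types carry no order, so triangularity is replaced by an algebraic argument: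
  multiplying two such matrices adds their lower blocks, hence the determinant turns sums of blocks
  into products.\<close>

lemma det_block_unitriangular_lower:
  fixes C :: "'a::field_char_0 ^ 'm::finite ^ 'n::finite"
  shows "det (block_matrix (mat 1) 0 C (mat 1)) = 1"
proof -
  let ?L = "\<lambda>X. block_matrix (mat 1) 0 X (mat 1) :: 'a ^ ('m + 'n) ^ ('m + 'n)"
  let ?E = "\<lambda>a. block_matrix (mat 1) 0 0 (mat a) :: 'a ^ ('m + 'n) ^ ('m + 'n)"
  have add: "det (?L (X + Y)) = det (?L X) * det (?L Y)" for X Y
    by (simp add: det_mul[symmetric] block_matrix_mult add.commute)
  \<comment> \<open>Characteristic zero enters here, through the inverse of 2.\<close>
  have inv: "det (?E 2) * det (?E (1/2)) = 1"
  proof -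
    have "?E 2 ** ?E (1/2) = mat 1"
      unfolding block_matrix_mult
      by (rule block_matrix_eqI[symmetric]) (simp_all add: mat_nth)
    from arg_cong[OF this, of det] show ?thesis by (simp add: det_mul)
  qed
  \<comment> \<open>Conjugation by the diagonal matrix turns the block C into 2 C, so the determinant equals its own square.\<close>
  have "?E 2 ** ?L C ** ?E (1/2) = ?L (C + C)"
    by (rule block_matrix_eqI) (simp_all add: block_matrix_mult mat_mult)
  from arg_cong[OF this, of det]
  have "det (?E 2) * det (?L C) * det (?E (1/2)) = det (?L C) * det (?L C)"
    by (simp only: det_mul add)
  also have "det (?E 2) * det (?L C) * det (?E (1/2)) = det (?E 2) * det (?E (1/2)) * det (?L C)"
    by (simp only: mult_ac)
  finally have "det (?L C) * det (?L C) = det (?L C)"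
    by (simp only: inv mult_1)
  \<comment> \<open>The matrices for \<open>C\<close> and \<open>- C\<close> are mutually inverse,
    which excludes the idempotent value 0.\<close>
  moreover have "det (?L C) * det (?L (- C)) = 1"
    using add[of C "- C"] by (simp add: mat_eq_block_matrix[symmetric])
  then have "det (?L C) \<noteq> 0" by auto
  ultimately show ?thesis by simp
qed

lemma det_block_unitriangular_upper:
  fixes B :: "'a::field_char_0 ^ 'n::finite ^ 'm::finite"
  shows "det (block_matrix (mat 1) B 0 (mat 1)) = 1"
proof -
  have "transpose (block_matrix (mat 1) B 0 (mat 1))
      = block_matrix (mat 1) 0 (transpose B) (mat 1)"
    by (rule block_matrix_eqI) (simp_all add: transpose_def mat_nth eq_commute)
  then show ?thesis
    by (metis det_block_unitriangular_lower det_transpose)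
qed

text \<open>Passes from a first-order system in companion form to its quadratic matrix polynomial.
  No inverse of \<open>z\<close> is taken, so \<open>z = 0\<close> is covered. The identity padding
  keeps the size of the matrix.\<close>

lemma det_block_companion:
  fixes C :: "'a::field_char_0 ^ 'n::finite ^ 'n"
  shows "det (block_matrix (mat z) (mat (- 1)) C (mat g))
    = det (block_matrix (mat 1) 0 0 (C + mat (z * g)) :: 'a ^ ('n + 'n) ^ ('n + 'n))"
proof -
  let ?M = "block_matrix (mat z) (mat (- 1)) C (mat g) :: 'a ^ ('n + 'n) ^ ('n + 'n)"
  let ?U = "\<lambda>a. block_matrix (mat 1) (mat a) 0 (mat 1) :: 'a ^ ('n + 'n) ^ ('n + 'n)"
  let ?L = "\<lambda>a. block_matrix (mat 1) 0 (mat a) (mat 1) :: 'a ^ ('n + 'n) ^ ('n + 'n)"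
  \<comment> \<open>The three unitriangular factors multiply to the block matrix with rows
    \<open>0, 1\<close> and \<open>- 1, z\<close>: a swap of the block columns, with a sign making
    its determinant 1, that also clears \<open>z\<close> from the top row.\<close>
  have "?M ** (?U 1 ** ?L (- 1) ** ?U (1 - z))
      = ?L (- g) ** block_matrix (mat 1) 0 0 (C + mat (z * g))"
    unfolding block_matrix_mult
    by (rule block_matrix_eqI) (auto simp: mat_add mat_mult mat_nth algebra_simps)
  from arg_cong[OF this, of det] show ?thesis
    by (simp add: det_mul det_block_unitriangular_upper det_block_unitriangular_lower)
qed

text \<open>The lower block acts as \<open>p + N q\<close> on constant vectors and as
  \<open>p\<close> on vectors with coordinate sum zero, which form a space of dimension
  \<open>N - 1\<close>, where \<open>N = CARD('n)\<close>.\<close>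

lemma det_block_scalar_plus_ones:
  fixes p q :: "'a::field"
  shows "det (block_matrix (mat 1) 0 0 (\<chi> i j. (if i = j then p else 0) + q)
      :: 'a ^ ('n::finite + 'n) ^ ('n + 'n))
    = p ^ (CARD('n) - 1) * (p + of_nat CARD('n) * q)"
proof -
  \<comment> \<open>The padding becomes diagonal entries 1 on which the perturbation vanishes, so
    the rank-one formula applies to the whole sum type.\<close>
  define d u w :: "'n + 'n \<Rightarrow> 'a"
    where "d = case_sum (\<lambda>_. 1) (\<lambda>_. p)" and "u = case_sum (\<lambda>_. 0) (\<lambda>_. q)"
      and "w = case_sum (\<lambda>_. 0) (\<lambda>_. 1)"
  have remove: "(\<Prod>k\<in>UNIV - {Inr i}. d k) = p ^ (CARD('n) - 1)" for i
  proof -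
    have "UNIV - {Inr i :: 'n + 'n} = UNIV <+> (UNIV - {i})" by (auto simp: UNIV_sum)
    then show ?thesis
      by (simp add: prod.Plus d_def)
  qed
  have "block_matrix (mat 1) 0 0 (\<chi> i j. (if i = j then p else 0) + q)
      = (\<chi> k. axis k (d k) + u k *s (\<chi> k. w k))"
    by (rule block_matrix_eqI[symmetric]) (auto simp: d_def u_def w_def axis_def mat_nth)
  also have "det \<dots> = p ^ CARD('n) + of_nat CARD('n) * q * p ^ (CARD('n) - 1)"
    by (simp add: det_diagonal_plus_rank_one sum_UNIV_Plus prod_UNIV_Plus remove)
      (simp add: d_def u_def w_def)
  \<comment> \<open>A factor \<open>p\<close> can be split off because a finite type is nonempty, so
    the natural subtraction in the exponent is exact.\<close>
  also have "p ^ CARD('n) = p ^ (CARD('n) - 1) * p"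
    by (metis One_nat_def Suc_pred mult.commute power_Suc zero_less_card_finite)
  finally show ?thesis by (simp add: algebra_simps)
qed

section \<open>The two Jacobians of the vector field\<close>

lemma has_derivative_vecI:
  fixes f :: "'a::real_normed_vector \<Rightarrow> real ^ 'n"
  assumes "\<And>k. ((\<lambda>x. f x $ k) has_derivative (\<lambda>h. f' h $ k)) (at a within S)"
  shows "(f has_derivative f') (at a within S)"
  unfolding has_derivative_componentwise_within[of f]
  using assms by (auto simp: Basis_vec_def inner_axis)

lemma jacobian_eqI:
  assumes "(f has_derivative f') (at x)"
  shows "jacobian f (at x) = matrix f'"
  by (metis assms frechet_derivative_at jacobian_def)

text \<open>With the delayed state frozen at 0, the \<open>N - 1\<close> coupling terms of
  oscillator \<open>i\<close> coincide and cancel the normalisation \<open>1 / (N - 1)\<close>. Only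
  its own phase and velocity remain, so every block is scalar.\<close>

lemma jac_A0_eq:
  assumes "CARD('n::finite) \<ge> 2"
  shows "jac_A0 K \<mu> \<omega>M \<tau> \<Omega>
    = block_matrix 0 (mat 1) (mat (- K * \<mu> * cos ((\<Omega> + \<omega>M) * \<tau>))) (mat (- \<mu>) :: real ^ 'n ^ 'n)"
    (is "_ = ?B")
proof -
  define B where "B = ?B"
  have "real CARD('n) - 1 \<noteq> 0" "real (CARD('n) - 1) = real CARD('n) - 1"
    using assms by (simp_all add: of_nat_diff)
  then have F: "phase_field K \<mu> \<omega>M \<tau> \<Omega> x 0 $ Inr i
      = - \<mu> * x $ Inr i - \<mu> * \<Omega> + K * \<mu> * sin (- x $ Inl i - (\<Omega> + \<omega>M) * \<tau>)"
    for x :: "real ^ ('n + 'n)" and i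
    by (simp add: phase_field_def distrib_right diff_diff_eq card_Diff_singleton)
  have mv: "(B *v h) $ Inl i = h $ Inr i"
    "(B *v h) $ Inr i = - K * \<mu> * cos ((\<Omega> + \<omega>M) * \<tau>) * h $ Inl i - \<mu> * h $ Inr i" for h i
    by (simp_all add: B_def matrix_vector_mult_def sum_UNIV_Plus mat_nth if_distrib[of "\<lambda>x. x * _"] cong: if_cong)
  have "((\<lambda>x. phase_field K \<mu> \<omega>M \<tau> \<Omega> x 0) has_derivative (*v) B) (at 0)"
  proof (rule has_derivative_vecI)
    fix k :: "'n + 'n"
    show "((\<lambda>x. phase_field K \<mu> \<omega>M \<tau> \<Omega> x 0 $ k) has_derivative (\<lambda>h. (B *v h) $ k)) (at 0)"
    proof (cases k)
      case (Inl i)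
      then show ?thesis
        by (simp add: phase_field_def mv bounded_linear_imp_has_derivative bounded_linear_vec_nth)
    next
      case (Inr i)
      have "((\<lambda>x. - \<mu> * x $ Inr i - \<mu> * \<Omega>
          + K * \<mu> * sin (- x $ Inl i - (\<Omega> + \<omega>M) * \<tau>)) has_derivative
          (\<lambda>h. - K * \<mu> * cos ((\<Omega> + \<omega>M) * \<tau>) * h $ Inl i - \<mu> * h $ Inr i)) (at 0)"
        by (auto intro!: derivative_eq_intros bounded_linear.has_derivative[OF bounded_linear_vec_nth])
      then show ?thesis
        using Inr by (simp only: F mv)
    qed
  qed
  then show ?thesis
    unfolding jac_A0_def by (simp add: jacobian_eqI B_def)
qed

text \<open>The delayed state enters only the acceleration, through the phases of the other
  oscillators; this leaves one nonzero block, with zero diagonal.\<close>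

lemma jac_Atau_eq:
  "jac_Atau K \<mu> \<omega>M \<tau> \<Omega>
    = block_matrix 0 0
        (\<chi> i j. if i = j then 0 else K * \<mu> / (real CARD('n::finite) - 1) * cos ((\<Omega> + \<omega>M) * \<tau>))
        (0 :: real ^ 'n ^ 'n)"
    (is "_ = ?B")
proof -
  define B where "B = ?B"
  \<comment> \<open>Turns the zero diagonal into the sum over \<open>j\<close> different from
    \<open>i\<close> that occurs in the vector field.\<close>
  have "(\<Sum>j\<in>UNIV. (if i = j then 0 else a) * g j) = a * (\<Sum>j\<in>UNIV - {i}. g j)"
    for i :: 'n and a :: real and g
    by (simp add: sum.remove[of UNIV i] sum_distrib_left)
  then have mv: "(B *v h) $ Inl i = 0"
    "(B *v h) $ Inr i = K * \<mu> / (real CARD('n) - 1)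
      * (\<Sum>j\<in>UNIV - {i}. cos ((\<Omega> + \<omega>M) * \<tau>) * h $ Inl j)" for h i
    by (simp_all add: B_def matrix_vector_mult_def sum_UNIV_Plus sum_distrib_left[symmetric])
  have "((\<lambda>y. phase_field K \<mu> \<omega>M \<tau> \<Omega> 0 y) has_derivative (*v) B) (at 0)"
  proof (rule has_derivative_vecI)
    fix k :: "'n + 'n"
    show "((\<lambda>y. phase_field K \<mu> \<omega>M \<tau> \<Omega> 0 y $ k) has_derivative (\<lambda>h. (B *v h) $ k)) (at 0)"
    proof (cases k)
      case (Inl i)
      then show ?thesis by (simp add: phase_field_def mv)
    next
      case (Inr i)
      \<comment> \<open>The coupling constant is abstracted to \<open>a\<close>, so that
        differentiation meets a plain factor instead of a quotient.\<close>
      have "((\<lambda>y. - \<mu> * \<Omega> + a * (\<Sum>j\<in>UNIV - {i}. sin (y $ Inl j - (\<Omega> + \<omega>M) * \<tau>))) has_derivative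
          (\<lambda>h. a * (\<Sum>j\<in>UNIV - {i}. cos ((\<Omega> + \<omega>M) * \<tau>) * h $ Inl j))) (at 0)" for a
        by (auto simp: mult.commute intro!: derivative_eq_intros bounded_linear.has_derivative[OF bounded_linear_vec_nth])
      from this[of "K * \<mu> / (real CARD('n) - 1)"] show ?thesis
        using Inr by (simp add: phase_field_def mv distrib_right diff_diff_eq)
    qed
  qed
  then show ?thesis
    unfolding jac_Atau_def by (simp add: jacobian_eqI B_def)
qed

section \<open>The characteristic matrix and the factorization of its determinant\<close>

text \<open>In the lower left block the instantaneous Jacobian supplies only the diagonal and the
  delayed one only the off-diagonal entries, so the two never meet in one entry.\<close>

lemma char_matrix_eq:
  assumes "CARD('n::finite) \<ge> 2"
  shows "char_matrix K \<mu> \<omega>M \<Omega> z \<tau>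
    = block_matrix (mat z) (mat (- 1))
        (\<chi> i j. if i = j then of_real (K * \<mu> * cos ((\<Omega> + \<omega>M) * \<tau>))
          else - (of_real (K * \<mu> / (real CARD('n) - 1) * cos ((\<Omega> + \<omega>M) * \<tau>)) * exp (- z * of_real \<tau>)))
        (mat (z + of_real \<mu>) :: complex ^ 'n ^ 'n)"
  unfolding char_matrix_def jac_A0_eq[OF assms] jac_Atau_eq
  by (rule block_matrix_eqI) (simp_all add: mat_nth)

theorem mainTheorem3:
  fixes K \<mu> \<omega>M \<tau> \<Omega> W :: real
  assumes "CARD('n::finite) \<ge> 2"
    and "K > 0" and "\<mu> > 0" and "\<omega>M > 0" and "\<tau> \<ge> 0"
    and "\<Omega> = - K * sin ((\<Omega> + \<omega>M) * \<tau>)"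
    and "W = \<Omega> + \<omega>M"
  shows "(\<forall>z::complex.
            det (char_matrix K \<mu> \<omega>M \<Omega> z \<tau> :: complex ^ ('n + 'n) ^ ('n + 'n))
              = P_Fix K \<mu> W z \<tau> * (P_U CARD('n) K \<mu> W z \<tau>) ^ (CARD('n) - 1))
         \<and> P_Fix K \<mu> W 0 \<tau> = 0"
proof (intro conjI allI)
  fix z :: complex
  define c where "c = complex_of_real (K * \<mu> * cos (W * \<tau>))"
  define e where "e = exp (- z * of_real \<tau>)"
  define b where "b = of_real (K * \<mu> / (real CARD('n) - 1) * cos (W * \<tau>)) * e"
  \<comment> \<open>Chosen so that the reduced block, with diagonal
    \<open>c + z * (z + \<mu>)\<close> and off-diagonal entries \<open>- b\<close>, is
    \<open>p\<close> times the identity minus \<open>b\<close> times the all-ones matrix.\<close>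
  define p where "p = z\<^sup>2 + of_real \<mu> * z + c + b"
  \<comment> \<open>The aim is \<open>Nb\<close>: as \<open>(N - 1) * b = c * e\<close>, the factor
    \<open>p - N * b\<close> loses its \<open>b\<close> and becomes \<open>P_Fix\<close>.\<close>
  have "real CARD('n) - 1 \<noteq> 0"
    using assms(1) by simp
  then have "(real CARD('n) - 1) * (K * \<mu> / (real CARD('n) - 1) * cos (W * \<tau>))
      = K * \<mu> * cos (W * \<tau>)"
    by simp
  then have "complex_of_real (real CARD('n) - 1)
      * of_real (K * \<mu> / (real CARD('n) - 1) * cos (W * \<tau>)) = c"
    unfolding c_def of_real_mult[symmetric] by (rule arg_cong)
  then have "complex_of_real (real CARD('n) - 1) * b = c * e"
    unfolding b_def by (simp only: mult.assoc[symmetric])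
  then have Nb: "of_nat CARD('n) * b = b + c * e"
    by (simp add: left_diff_distrib diff_eq_eq add.commute)
  have "char_matrix K \<mu> \<omega>M \<Omega> z \<tau>
      = block_matrix (mat z) (mat (- 1)) (\<chi> i j. if i = j then c else - b)
          (mat (z + of_real \<mu>) :: complex ^ 'n ^ 'n)"
    unfolding char_matrix_eq[OF assms(1)] b_def c_def e_def assms(7) ..
  then have "det (char_matrix K \<mu> \<omega>M \<Omega> z \<tau> :: complex ^ ('n + 'n) ^ ('n + 'n))
      = det (block_matrix (mat 1) 0 0 ((\<chi> i j. if i = j then c else - b) + mat (z * (z + of_real \<mu>)))
          :: complex ^ ('n + 'n) ^ ('n + 'n))"
    by (simp only: det_block_companion)
  also have "((\<chi> i j. if i = j then c else - b) + mat (z * (z + of_real \<mu>)) :: complex ^ 'n ^ 'n)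
      = (\<chi> i j. (if i = j then p else 0) + - b)"
    by (simp add: vec_eq_iff mat_nth p_def algebra_simps power2_eq_square)
  also have "det (block_matrix (mat 1) 0 0 \<dots> :: complex ^ ('n + 'n) ^ ('n + 'n))
      = p ^ (CARD('n) - 1) * (p + of_nat CARD('n) * - b)"
    by (rule det_block_scalar_plus_ones)
  also have "p + of_nat CARD('n) * - b = P_Fix K \<mu> W z \<tau>"
    by (simp add: Nb p_def) (simp add: P_Fix_def c_def e_def)
  also have "p = P_U CARD('n) K \<mu> W z \<tau>"
    by (simp add: P_U_def p_def b_def c_def e_def)
  finally show "det (char_matrix K \<mu> \<omega>M \<Omega> z \<tau> :: complex ^ ('n + 'n) ^ ('n + 'n))
      = P_Fix K \<mu> W z \<tau> * (P_U CARD('n) K \<mu> W z \<tau>) ^ (CARD('n) - 1)"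
    by (simp only: mult.commute)
next
  \<comment> \<open>At \<open>z = 0\<close> the exponential is 1 and the two cosine terms
    cancel.\<close>
  show "P_Fix K \<mu> W 0 \<tau> = 0"
    by (simp add: P_Fix_def)
qed

end
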